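(* For the class of (finite) nilpotent $\alpha$-groups, the partitions $P_1,P_2,P_6$ induced by the equivalence relations $\sim_1,\sim_2,\sim_6$ satisfy $$P_1<P_2=P_6.$$
   Context: For a finite group $G$, $\# G$ is its order, $1_G$ its identity, $\mathrm{ord}(g)$ the order of $g\in G$, and $\mathcal O(G)$ is the multiset $\{\mathrm{ord}(g): g\in G\}$ (counted with multiplicity). $\mathcal C_G$ is the set of all cyclic subgroups of $G$ and, for a prime $p$, $\mathcal C_G^{(p)}$ is the set of cyclic subgroups of $G$ whose order equals $p^i$ for some $i\ge 0$. For nonempty $S\subseteq\mathcal C_G$, put $\cup S=\bigcup_{C\in S}C\subseteq G$. A nonempty $S\subseteq\mathcal C_G$ is hereditary if every subgroup of every $C\in S$ belongs to $S$. A nonempty subset $S\subseteq\mathcal C_G$ is an $\alpha$-set if $S$ is hereditary and there is a prime divisor $p$ of $\# G$ such that: (i) $S\subseteq\mathcal C_G^{(p)}$; (ii) for each $i\ge 1$ and every $g\in\cup S$, the number of solutions $x\in\cup S$ of $x^{p^i}=g$ is either $0$ or $n_i(S):=\#\{x\in\cup S: x^{p^i}=1_G\}$. A finite group $G$ is an $\alpha$-group if $\mathcal C_G^{(p)}$ is an $\alpha$-set for every prime divisor $p$ of $\# G$. Relations on finite groups $G,H$: $G\sim_1 H$ if $G\cong H$ as groups; $G\sim_2 H$ if there is a bijection $\varphi:G\to H$ with $\varphi(g^t)=\varphi(g)^t$ for all $g\in G$, $t\in\mathbb Z$; $G\sim_6 H$ if $\mathcal O(G)=\mathcal O(H)$.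 For a class of finite groups, $P_j$ is the partition of the set of isomorphism classes of groups in the class induced by $\sim_j$. $P_j\le P_k$ means that $G\sim_j H$ implies $G\sim_k H$ for all $G,H$ in the class; $P_j=P_k$ means the two relations coincide on the class; $P_j<P_k$ means $P_j\le P_k$ and $P_j\ne P_k$. *)

theory Defs
  imports "HOL-Algebra.Algebra" "HOL-Library.Multiset"
begin

definition finite_group :: "'a monoid \<Rightarrow> bool" where
  "finite_group G \<longleftrightarrow> group G \<and> finite (carrier G)"

definition cyclic_subgroups :: "'a monoid \<Rightarrow> 'a set set" where
  "cyclic_subgroups G = {C. subgroup C G \<and> cyclic_group (G\<lparr>carrier := C\<rparr>)}"

definition cyclic_p_subgroups :: "nat \<Rightarrow> 'a monoid \<Rightarrow> 'a set set" where
  "cyclic_p_subgroups p G = {C \<in> cyclic_subgroups G. \<exists>i::nat. card C = p ^ i}"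

definition hereditary :: "'a monoid \<Rightarrow> 'a set set \<Rightarrow> bool" where
  "hereditary G S \<longleftrightarrow>
     S \<noteq> {} \<and> S \<subseteq> cyclic_subgroups G \<and>
     (\<forall>C\<in>S. \<forall>D. subgroup D (G\<lparr>carrier := C\<rparr>) \<longrightarrow> D \<in> S)"

definition alpha_set :: "'a monoid \<Rightarrow> 'a set set \<Rightarrow> bool" where
  "alpha_set G S \<longleftrightarrow>
     hereditary G S \<and>
     (\<exists>p::nat. Factorial_Ring.prime p \<and> p dvd order G \<and>
        S \<subseteq> cyclic_p_subgroups p G \<and>
        (\<forall>i\<ge>1. \<forall>g\<in>\<Union>S.
           card {x \<in> \<Union>S. x [^]\<^bsub>G\<^esub> (p ^ i) = g}
             \<in> {0, card {x \<in> \<Union>S. x [^]\<^bsub>G\<^esub> (p ^ i) = \<one>\<^bsub>G\<^esub>}}))"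

definition alpha_group :: "'a monoid \<Rightarrow> bool" where
  "alpha_group G \<longleftrightarrow>
     finite_group G \<and>
     (\<forall>p::nat. Factorial_Ring.prime p \<and> p dvd order G \<longrightarrow> alpha_set G (cyclic_p_subgroups p G))"

text \<open>The lower central series, with the commutator convention of \<^const>\<open>derived\<close>.\<close>

fun lower_central :: "'a monoid \<Rightarrow> nat \<Rightarrow> 'a set" where
  "lower_central G 0 = carrier G"
| "lower_central G (Suc n) =
     generate G (\<Union>h\<in>lower_central G n. \<Union>g\<in>carrier G.
       {h \<otimes>\<^bsub>G\<^esub> g \<otimes>\<^bsub>G\<^esub> inv\<^bsub>G\<^esub> h \<otimes>\<^bsub>G\<^esub> inv\<^bsub>G\<^esub> g})"

definition nilpotent_group :: "'a monoid \<Rightarrow> bool" where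
  "nilpotent_group G \<longleftrightarrow> group G \<and> (\<exists>n. lower_central G n = {\<one>\<^bsub>G\<^esub>})"

definition nilpotent_alpha_group :: "'a monoid \<Rightarrow> bool" where
  "nilpotent_alpha_group G \<longleftrightarrow> nilpotent_group G \<and> alpha_group G"

definition order_multiset :: "'a monoid \<Rightarrow> nat multiset" where
  "order_multiset G = image_mset (group.ord G) (mset_set (carrier G))"

definition sim1 :: "'a monoid \<Rightarrow> 'b monoid \<Rightarrow> bool" (infix \<open>\<sim>\<^sub>1\<close> 50) where
  "G \<sim>\<^sub>1 H \<longleftrightarrow> G \<cong> H"

definition sim2 :: "'a monoid \<Rightarrow> 'b monoid \<Rightarrow> bool" (infix \<open>\<sim>\<^sub>2\<close> 50) where
  "G \<sim>\<^sub>2 H \<longleftrightarrow>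
     (\<exists>\<phi>. bij_betw \<phi> (carrier G) (carrier H) \<and>
          (\<forall>g\<in>carrier G. \<forall>t::int. \<phi> (g [^]\<^bsub>G\<^esub> t) = \<phi> g [^]\<^bsub>H\<^esub> t))"

definition sim6 :: "'a monoid \<Rightarrow> 'b monoid \<Rightarrow> bool" (infix \<open>\<sim>\<^sub>6\<close> 50) where
  "G \<sim>\<^sub>6 H \<longleftrightarrow> order_multiset G = order_multiset H"

text \<open>
  Comparison of the partitions induced by two relations on the class of nilpotent
  alpha-groups.  The two carrier types may differ.  A non-coincidence should be stated
  over a carrier type such as \<^typ>\<open>nat\<close>, which realises every finite group up to
  isomorphism: over a small finite type, distinct relations can coincide.
\<close>

definition partition_le ::
  "('a monoid \<Rightarrow> 'b monoid \<Rightarrow> bool) \<Rightarrow> ('a monoid \<Rightarrow> 'b monoid \<Rightarrow> bool) \<Rightarrow> bool" where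
  "partition_le R R' \<longleftrightarrow>
     (\<forall>G H. nilpotent_alpha_group G \<and> nilpotent_alpha_group H \<longrightarrow> R G H \<longrightarrow> R' G H)"

definition partition_eq ::
  "('a monoid \<Rightarrow> 'b monoid \<Rightarrow> bool) \<Rightarrow> ('a monoid \<Rightarrow> 'b monoid \<Rightarrow> bool) \<Rightarrow> bool" where
  "partition_eq R R' \<longleftrightarrow>
     (\<forall>G H. nilpotent_alpha_group G \<and> nilpotent_alpha_group H \<longrightarrow> (R G H \<longleftrightarrow> R' G H))"

end

theory Submission
  imports Defs
begin

text \<open>
  Isomorphisms respect powers, and bijections that respect powers preserve element orders; this gives the
  easy inclusions. The first of them is strict because of the Heisenberg group of order 27 and the
  elementary abelian group of order 27. In both, every nontrivial element has order 3, so the order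
  multisets agree, the alpha condition holds for trivial reasons, and both are nilpotent; but only one is
  abelian (\<open>heisenberg27_nilpotent_alpha\<close>, \<open>heisenberg27_not_iso\<close>). That they are related by a bijection respecting
  powers follows from the general fact below.

  The substance is that, for nilpotent alpha-groups $G$ and $H$, equal order multisets yield a bijection that
  respects powers. For a prime $p$, let the height of a $p$-element be the largest $i$ for which it is a
  $p^i$-th power. By the alpha condition, all nonempty fibres of the map $x \mapsto x^{p^i}$ on $p$-elements have the
  same size $n_i$, the number of solutions of $x^{p^i} = 1$, which the order multiset determines. Consequently the number of
  $p$-th roots of $g$ that have height at least $i$ is $n_{i+1}/n_i$ if $g$ has height at least $i+1$,
  and 0 otherwise (\<open>alpha_group_branching\<close>). So the height of $g$ and the order multiset govern how the
  $p$-elements branch above $g$ under the $p$-th power map.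

  This is used to extend partial isomorphisms of the power structure that preserve heights
  (\<open>partial_power_iso\<close>), one cyclic subgroup at a time. Let $x$ be an element of minimal order
  outside the domain of such a map $f$. If the order of $x$ is a power of $p$, counting the $p$-th roots of $x^p$ and
  of $f(x^p)$ that have the height of $x$ shows that one of the latter is still free, and $x$ is sent there
  (\<open>extend_prime_power\<close>). Otherwise $x$ is a product of two of its own powers of coprime smaller
  orders, and it is sent to the product of their images (\<open>extend_composite\<close>). For this the images must
  commute, and here nilpotency enters (\<open>nilpotent_coprime_commute\<close>).
\<close>

section \<open>Powers in groups\<close>

lemma (in group) pow_cong:
  assumes "x \<in> carrier G" "x [^] (m::nat) = \<one>" "i mod m = j mod m"
  shows "x [^] i = x [^] j"
proof -
  have red: "x [^] k = x [^] (k mod m)" for k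
  proof -
    have "x [^] k = (x [^] m) [^] (k div m) \<otimes> x [^] (k mod m)"
      using assms(1) by (simp add: nat_pow_pow nat_pow_mult)
    then show ?thesis using assms by simp
  qed
  show ?thesis
    using assms(3) red[of i] red[of j] by simp
qed

lemma (in group) inv_cancel_left:
  "k \<in> carrier G \<Longrightarrow> w \<in> carrier G \<Longrightarrow> inv k \<otimes> (k \<otimes> w) = w"
  by (metis inv_solve_left m_closed)

lemma (in group) prime_power_orders_eq:
  assumes "x \<in> carrier G" "x \<noteq> \<one>" "Factorial_Ring.prime p" "Factorial_Ring.prime q"
    and "x [^] ((p::nat) ^ k) = \<one>" "x [^] (q ^ j) = \<one>"
  shows "p = q"
proof (rule ccontr)
  assume "p \<noteq> q"
  then have "coprime (p ^ k) (q ^ j)"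
    using assms by (simp add: primes_coprime)
  moreover have "ord x dvd p ^ k" "ord x dvd q ^ j"
    using assms pow_eq_id by blast+
  ultimately have "ord x = 1"
    by (metis coprime_common_divisor_nat)
  then show False using assms ord_eq_1 by blast
qed

text \<open>
  The numbers $u$ and $v$ are the two complementary idempotents of the residue ring modulo $ml$. Raising
  an element of order dividing $ml$ to the powers $u$ and $v$ therefore splits it into its two
  components, of orders dividing $l$ and $m$ respectively.
\<close>

lemma coprime_idempotents:
  fixes m l :: nat
  assumes "coprime m l" "m > 0" "l > 0"
  obtains u v where "m dvd u" "l dvd v" "(u + v) mod (m * l) = 1 mod (m * l)"
proof -
  obtain a b where ab: "m * a = l * b + 1"
    using bezout_nat[of m l] assms by auto
  obtain c d where cd: "l * c = m * d + 1"
    using bezout_nat[of l m] assms by (auto simp: coprime_iff_gcd_eq_1 gcd.commute)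
  have "m * a + l * c - 1 = m * (a + d)" "m * a + l * c - 1 = l * (b + c)"
    using ab cd by (simp_all add: algebra_simps)
  then have "m dvd m * a + l * c - 1" "l dvd m * a + l * c - 1"
    by (metis dvd_triv_left)+
  then have "m * l dvd (m * a + l * c) - 1"
    using assms(1) by (simp add: divides_mult)
  then have "(m * a + l * c) mod (m * l) = 1 mod (m * l)"
    using ab by (metis le_add2 mod_eq_dvd_iff_nat trans_le_add1)
  then show ?thesis
    by (intro that) auto
qed

section \<open>Coprime orders in nilpotent groups\<close>

lemma (in group) commutator_pow:
  assumes "x \<in> carrier G" "y \<in> carrier G" "c \<in> carrier G"
    and comm: "x \<otimes> y = c \<otimes> (y \<otimes> x)" and cx: "c \<otimes> x = x \<otimes> c"
  shows "x [^] i \<otimes> y = c [^] i \<otimes> (y \<otimes> x [^] (i::nat))"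
proof (induction i)
  case 0
  then show ?case using assms by simp
next
  case (Suc i)
  have "x [^] Suc i \<otimes> y = x [^] i \<otimes> c \<otimes> (y \<otimes> x)"
    using assms by (simp add: m_assoc)
  also have "\<dots> = c \<otimes> x [^] i \<otimes> (y \<otimes> x)"
    using assms by (metis group_commutes_pow)
  also have "\<dots> = c \<otimes> (x [^] i \<otimes> y) \<otimes> x"
    using assms by (simp add: m_assoc)
  also have "\<dots> = c \<otimes> c [^] i \<otimes> (y \<otimes> (x [^] i \<otimes> x))"
    unfolding Suc.IH using assms by (simp add: m_assoc)
  also have "\<dots> = c [^] Suc i \<otimes> (y \<otimes> x [^] Suc i)"
    using assms nat_pow_Suc2[of c i] by simp
  finally show ?case .
qed

text \<open>
  The commutator map is multiplicative in each variable as long as its values are central, so the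
  order of the commutator divides the orders of both arguments.
\<close>

lemma (in group) central_commutator_trivial:
  assumes xyc: "x \<in> carrier G" "y \<in> carrier G" "c \<in> carrier G"
    and comm: "x \<otimes> y = c \<otimes> (y \<otimes> x)"
    and cx: "c \<otimes> x = x \<otimes> c" and cy: "c \<otimes> y = y \<otimes> c"
    and xm: "x [^] (m::nat) = \<one>" and yn: "y [^] (n::nat) = \<one>" and mn: "coprime m n"
  shows "c = \<one>"
proof -
  have "c [^] m = \<one>"
    using commutator_pow[OF xyc comm cx, of m] xm xyc by simp
  moreover have "inv c [^] n = \<one>"
  proof -
    have "y \<otimes> x = inv c \<otimes> (x \<otimes> y)"
      using xyc comm by (simp add: inv_solve_left)
    moreover have "inv c \<otimes> y = y \<otimes> inv c"
      using xyc cy by (metis inv_closed inv_solve_left inv_solve_right m_assoc m_closed)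
    ultimately show ?thesis
      using commutator_pow[of y x "inv c" n] yn xyc by simp
  qed
  ultimately have "ord c dvd m" "ord c dvd n"
    using xyc pow_eq_id by (metis inv_closed ord_inv)+
  then have "ord c = 1"
    using mn by (metis coprime_common_divisor_nat)
  then show ?thesis using xyc ord_eq_1 by blast
qed

lemma lower_central_normal:
  fixes G :: "'a monoid" (structure)
  assumes "group G"
  shows "lower_central G n \<lhd> G"
proof -
  interpret group G by fact
  show ?thesis
  proof (induction n)
    case 0
    then show ?case
      by (auto simp: normal_inv_iff subgroup_self)
  next
    case (Suc n)
    then interpret N: normal "lower_central G n" G .
    have conj: "k \<otimes> (h \<otimes> g \<otimes> inv h \<otimes> inv g) \<otimes> inv k =
        (k \<otimes> h \<otimes> inv k) \<otimes> (k \<otimes> g \<otimes> inv k) \<otimes> inv (k \<otimes> h \<otimes> inv k) \<otimes> inv (k \<otimes> g \<otimes> inv k)"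
      if "h \<in> carrier G" "g \<in> carrier G" "k \<in> carrier G" for h g k
      using that by (simp add: m_assoc inv_mult_group inv_cancel_left)
    show ?case
      unfolding lower_central.simps
    proof (rule normal_generateI, goal_cases)
      case 1
      then show ?case using N.subset by auto
    next
      case (2 w k)
      then obtain h g where hg: "h \<in> lower_central G n" "g \<in> carrier G"
        "w = h \<otimes> g \<otimes> inv h \<otimes> inv g" by auto
      have "k \<otimes> h \<otimes> inv k \<in> lower_central G n"
        using 2 hg N.inv_op_closed2 by blast
      moreover have "k \<otimes> g \<otimes> inv k \<in> carrier G" using 2 hg by simp
      ultimately show ?case
        using conj[of h g k] hg 2 N.subset by auto
    qed
  qed
qed

text \<open>
  The commutator of $x$ and $y$ sinks down the lower central series: if it lies in one term, it is
  central modulo the next, and there the coprimality of the orders kills it. The series ends in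
  the trivial group.
\<close>

lemma nilpotent_coprime_commute:
  fixes G :: "'a monoid" (structure)
  assumes "nilpotent_group G" and x: "x \<in> carrier G" and y: "y \<in> carrier G"
    and xm: "x [^] (m::nat) = \<one>" and yn: "y [^] (n::nat) = \<one>" and mn: "coprime m n"
  shows "x \<otimes> y = y \<otimes> x"
proof -
  from assms obtain k where "group G" and k: "lower_central G k = {\<one>}"
    unfolding nilpotent_group_def by blast
  interpret group G by fact
  define c where "c = x \<otimes> y \<otimes> inv x \<otimes> inv y"
  have c: "c \<in> carrier G" using x y by (simp add: c_def)
  have xy: "x \<otimes> y = c \<otimes> (y \<otimes> x)"
    using x y by (simp add: c_def m_assoc inv_cancel_left)
  have "c \<in> lower_central G j" for j
  proof (induction j)
    case 0
    then show ?case using c by simp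
  next
    case (Suc j)
    define N where "N = lower_central G (Suc j)"
    interpret N: normal N G
      unfolding N_def using lower_central_normal[OF \<open>group G\<close>] .
    interpret Q: group "G Mod N" by (rule N.factorgroup_is_group)
    define f where "f = (\<lambda>g. N #> g)"
    have fc: "f g \<in> carrier (G Mod N)" if "g \<in> carrier G" for g
      using that by (auto simp: f_def carrier_FactGroup)
    have fm: "f (g \<otimes> h) = f g \<otimes>\<^bsub>G Mod N\<^esub> f h" if "g \<in> carrier G" "h \<in> carrier G" for g h
      using that by (simp add: f_def N.rcos_sum)
    have central: "f c \<otimes>\<^bsub>G Mod N\<^esub> f g = f g \<otimes>\<^bsub>G Mod N\<^esub> f c" if g: "g \<in> carrier G" for g
    proof -
      define d where "d = c \<otimes> g \<otimes> inv c \<otimes> inv g"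
      have d: "d \<in> N"
        using Suc.IH g unfolding d_def N_def lower_central.simps by (intro generate.incl) blast
      then have "d \<in> carrier G" using N.subset by blast
      have "c \<otimes> g = d \<otimes> (g \<otimes> c)"
        using c g by (simp add: d_def m_assoc inv_cancel_left)
      then have "f (c \<otimes> g) = f (g \<otimes> c)"
        using d \<open>d \<in> carrier G\<close> c g unfolding f_def
        by (metis N.subgroup_axioms N.subset coset_join2 coset_mult_assoc m_closed)
      then show ?thesis using fm c g by simp
    qed
    have fp: "f g [^]\<^bsub>G Mod N\<^esub> i = f (g [^] i)" if "g \<in> carrier G" for g and i :: nat
      using N.FactGroup_pow that by (simp add: f_def)
    \<comment> \<open>The relations for x and y persist in the quotient, where their commutator is central.\<close>
    have "f \<one> = \<one>\<^bsub>G Mod N\<^esub>"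
      by (simp add: f_def N.subset)
    then have "f c = \<one>\<^bsub>G Mod N\<^esub>"
      using fc fm x y c xm yn mn central xy fp
      by (intro Q.central_commutator_trivial[of "f x" "f y" "f c" m n]) (metis m_closed)+
    then have "c \<in> N"
      unfolding f_def using c N.subset by (metis coset_join1 one_FactGroup N.subgroup_axioms)
    then show ?case by (simp only: N_def)
  qed
  then have "c = \<one>" using k by blast
  then show ?thesis using xy x y by simp
qed

section \<open>Counting roots in alpha-groups\<close>

definition has_root :: "('a, 'b) monoid_scheme \<Rightarrow> nat \<Rightarrow> 'a \<Rightarrow> bool" where
  "has_root G n g \<longleftrightarrow> (\<exists>z\<in>carrier G. z [^]\<^bsub>G\<^esub> n = g)"

lemma (in group) has_root_pow: "has_root G n g \<Longrightarrow> has_root G n (g [^] (t::nat))"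
  unfolding has_root_def by (metis mult.commute nat_pow_closed nat_pow_pow)

lemma (in group) has_root_dvd:
  assumes "has_root G n g" "m dvd n"
  shows "has_root G m g"
  using assms unfolding has_root_def by (metis dvdE mult.commute nat_pow_closed nat_pow_pow)

lemma generate_in_cyclic_p_subgroups:
  fixes G :: "'a monoid" (structure)
  assumes "group G" "Factorial_Ring.prime p" and x: "x \<in> carrier G" "x [^] (p ^ k) = \<one>"
  shows "generate G {x} \<in> cyclic_p_subgroups p G"
proof -
  interpret group G by fact
  have "ord x dvd p ^ k"
    using x pow_eq_id by blast
  then obtain i where "ord x = p ^ i"
    using assms by (auto simp: divides_primepow_nat)
  then have "card (generate G {x}) = p ^ i"
    using x generate_pow_card by simp
  moreover have "subgroup (generate G {x}) G"
    using x by (simp add: generate_is_subgroup)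
  moreover have "cyclic_group (G\<lparr>carrier := generate G {x}\<rparr>)"
    using cyclic_group_generated[of x] x by (simp add: subgroup_generated_def)
  ultimately show ?thesis
    by (auto simp: cyclic_p_subgroups_def cyclic_subgroups_def)
qed

text \<open>
  The support of the set of cyclic subgroups of $p$-power order is the set of $p$-elements. This turns
  the alpha condition into a statement about elements.
\<close>

lemma Union_cyclic_p_subgroups:
  fixes G :: "'a monoid" (structure)
  assumes "group G" "Factorial_Ring.prime p"
  shows "\<Union>(cyclic_p_subgroups p G) = {x \<in> carrier G. \<exists>k. x [^] (p ^ k) = \<one>}" (is "?L = ?R")
proof -
  interpret group G by fact
  show ?thesis
  proof (intro equalityI subsetI)
    fix x assume "x \<in> ?L"
    then obtain C i where C: "x \<in> C" "subgroup C G" "card C = p ^ i"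
      by (auto simp: cyclic_p_subgroups_def cyclic_subgroups_def)
    interpret C: group "G\<lparr>carrier := C\<rparr>"
      using C by (simp add: subgroup.subgroup_is_group)
    have "x [^]\<^bsub>G\<lparr>carrier := C\<rparr>\<^esub> card C = \<one>"
      using C.pow_order_eq_1[of x] C by (simp add: order_def)
    then have "x [^] card C = \<one>"
      by (simp flip: nat_pow_consistent)
    then show "x \<in> ?R"
      using C subgroup.subset by auto
  next
    fix x assume "x \<in> ?R"
    then obtain k where x: "x \<in> carrier G" "x [^] (p ^ k) = \<one>" by blast
    moreover have "x \<in> generate G {x}"
      by (simp add: generate.incl)
    ultimately show "x \<in> ?L"
      using generate_in_cyclic_p_subgroups[OF assms] by blast
  qed
qed

text \<open>
  The definition of an alpha-set leaves its prime implicit; a nontrivial $p$-element in its support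
  forces that prime to be $p$. Moreover, every root of $p$-power degree of a $p$-element is itself a
  $p$-element, so counting in the support is the same as counting in the whole group.
\<close>

lemma alpha_group_root_count:
  fixes G :: "'a monoid" (structure)
  assumes \<alpha>: "alpha_group G" and p: "Factorial_Ring.prime p"
    and g: "g \<in> carrier G" "g [^] (p ^ k) = \<one>" and root: "has_root G (p ^ i) g"
  shows "card {x \<in> carrier G. x [^] (p ^ i) = g} = card {x \<in> carrier G. x [^] (p ^ i) = \<one>}"
proof -
  have "group G" and fin: "finite (carrier G)"
    using \<alpha> by (auto simp: alpha_group_def finite_group_def)
  interpret group G by fact
  consider "g = \<one>" | "i = 0" | "g \<noteq> \<one>" "i \<ge> 1" by linarith
  then show ?thesis
  proof cases
    case 2
    then have "{x \<in> carrier G. x [^] (p ^ i) = g} = {g}" "{x \<in> carrier G. x [^] (p ^ i) = \<one>} = {\<one>}"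
      using g by auto
    then show ?thesis by simp
  next
    case 3
    have pdvd: "p dvd order G"
    proof (rule ccontr)
      assume "\<not> p dvd order G"
      then have "coprime (p ^ k) (order G)"
        using p by (simp add: prime_imp_coprime)
      moreover have "ord g dvd p ^ k" "ord g dvd order G"
        using g pow_eq_id ord_dvd_group_order by blast+
      ultimately have "ord g = 1"
        by (metis coprime_common_divisor_nat)
      then show False using g 3 ord_eq_1 by blast
    qed
    let ?S = "cyclic_p_subgroups p G"
    have "alpha_set G ?S"
      using \<alpha> p pdvd by (simp add: alpha_group_def)
    then obtain p' where p': "Factorial_Ring.prime p'" and sub: "?S \<subseteq> cyclic_p_subgroups p' G"
      and count: "\<And>i g. i \<ge> 1 \<Longrightarrow> g \<in> \<Union>?S \<Longrightarrow> card {x \<in> \<Union>?S. x [^] (p' ^ i) = g}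
             \<in> {0, card {x \<in> \<Union>?S. x [^] (p' ^ i) = \<one>}}"
      unfolding alpha_set_def by blast
    have gS: "g \<in> \<Union>?S"
      using g by (auto simp: Union_cyclic_p_subgroups[OF \<open>group G\<close> p])
    with sub have "g \<in> \<Union>(cyclic_p_subgroups p' G)" by blast
    then obtain j where "g [^] (p' ^ j) = \<one>"
      using Union_cyclic_p_subgroups[OF \<open>group G\<close> p'] by blast
    then have "p' = p"
      using prime_power_orders_eq[of g p' p j k] g 3 p p' by blast
    have *: "{x \<in> \<Union>?S. x [^] (p ^ i) = h} = {x \<in> carrier G. x [^] (p ^ i) = h}"
      if h: "h \<in> carrier G" "h [^] (p ^ k) = \<one>" for h
    proof -
      have "x [^] (p ^ (i + k)) = \<one>" if "x \<in> carrier G" "x [^] (p ^ i) = h" for x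
        using that h by (metis nat_pow_pow power_add)
      then show ?thesis
        unfolding Union_cyclic_p_subgroups[OF \<open>group G\<close> p] by blast
    qed
    have "card {x \<in> carrier G. x [^] (p ^ i) = g} \<noteq> 0"
      using root fin by (auto simp: has_root_def)
    then show ?thesis
      using count[OF \<open>i \<ge> 1\<close> gS] \<open>p' = p\<close> g *[of g] *[of \<one>] by simp
  qed simp
qed

text \<open>
  Classify the solutions of $y^{p^{i+1}} = g$ by the value $x = y^{p^i}$, which is a $p$-th root of $g$
  that is a $p^i$-th power. The alpha condition makes all fibres equally large. Hence the number of
  $p$-th roots of $g$ that are themselves $p^i$-th powers depends only on the numbers of
  $p$-power torsion elements and on whether $g$ is a $p^{i+1}$-th power. This is what makes the tree of $p$-elements
  under the $p$-th power map reconstructible from element orders.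
\<close>

lemma alpha_group_branching:
  fixes G :: "'a monoid" (structure)
  assumes \<alpha>: "alpha_group G" and p: "Factorial_Ring.prime p"
    and g: "g \<in> carrier G" "g [^] (p ^ k) = \<one>"
  shows "card {x \<in> carrier G. has_root G (p ^ i) x \<and> x [^] p = g} * card {x \<in> carrier G. x [^] (p ^ i) = \<one>}
    = (if has_root G (p ^ Suc i) g then card {x \<in> carrier G. x [^] (p ^ Suc i) = \<one>} else 0)"
proof -
  have "group G" and fin: "finite (carrier G)"
    using \<alpha> by (auto simp: alpha_group_def finite_group_def)
  interpret group G by fact
  let ?X = "{x \<in> carrier G. has_root G (p ^ i) x \<and> x [^] p = g}"
  let ?Y = "\<lambda>x. {y \<in> carrier G. y [^] (p ^ i) = x}"
  have "{y \<in> carrier G. y [^] (p ^ Suc i) = g} = (\<Union>x\<in>?X. ?Y x)"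
    by (auto simp: has_root_def nat_pow_pow mult.commute)
  then have "card {y \<in> carrier G. y [^] (p ^ Suc i) = g} = (\<Sum>x\<in>?X. card (?Y x))"
    using fin by (simp only:) (rule card_UN_disjoint; auto)
  also have "\<dots> = (\<Sum>x\<in>?X. card (?Y \<one>))"
  proof (rule sum.cong[OF refl])
    fix x assume x: "x \<in> ?X"
    then have "x [^] (p ^ Suc k) = \<one>"
      using g by (auto simp flip: nat_pow_pow)
    then show "card (?Y x) = card (?Y \<one>)"
      using alpha_group_root_count[OF \<alpha> p, of x "Suc k" i] x by blast
  qed
  finally have "card ?X * card (?Y \<one>) = card {y \<in> carrier G. y [^] (p ^ Suc i) = g}"
    by simp
  also have "\<dots> = (if has_root G (p ^ Suc i) g then card {x \<in> carrier G. x [^] (p ^ Suc i) = \<one>} else 0)"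
  proof (cases "has_root G (p ^ Suc i) g")
    case True
    then show ?thesis
      using alpha_group_root_count[OF \<alpha> p g True] by simp
  next
    case False
    then have "{y \<in> carrier G. y [^] (p ^ Suc i) = g} = {}"
      by (auto simp: has_root_def)
    then show ?thesis using False by (metis card.empty)
  qed
  finally show ?thesis .
qed

lemma card_roots_of_one_eq_size_filter:
  fixes G :: "'a monoid" (structure)
  assumes "finite_group G"
  shows "card {x \<in> carrier G. x [^] (m::nat) = \<one>} = size (filter_mset (\<lambda>d. d dvd m) (order_multiset G))"
proof -
  interpret group G using assms by (simp add: finite_group_def)
  have "{x \<in> carrier G. x [^] m = \<one>} = {x \<in> carrier G. ord x dvd m}"
    using pow_eq_id by blast
  then show ?thesis
    using assms by (simp add: finite_group_def order_multiset_def filter_mset_image_mset comp_def)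
qed

section \<open>Extending partial isomorphisms of the power structure\<close>

text \<open>
  The last condition carries the induction. It says that $f$ preserves the height of every
  $p$-element, the largest $i$ for which the element is a $p^i$-th power in the whole group. Without it, $f$ could
  map an element to one with fewer roots and could not be extended upwards.
\<close>

locale partial_power_iso = G: group G + H: group H
  for G :: "'a monoid" (structure) and H :: "'b monoid" +
  fixes A :: "'a set" and f :: "'a \<Rightarrow> 'b"
  assumes finG: "finite (carrier G)" and finH: "finite (carrier H)"
    and A_sub: "A \<subseteq> carrier G" and one_A: "\<one> \<in> A"
    and pow_A: "a \<in> A \<Longrightarrow> a [^] (t::nat) \<in> A"
    and f_carrier: "a \<in> A \<Longrightarrow> f a \<in> carrier H"
    and f_pow: "a \<in> A \<Longrightarrow> f (a [^] (t::nat)) = f a [^]\<^bsub>H\<^esub> t"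
    and f_inj: "inj_on f A"
    and f_root: "\<lbrakk>a \<in> A; Factorial_Ring.prime p; a [^] (p ^ k) = \<one>\<rbrakk>
      \<Longrightarrow> has_root G (p ^ i) a \<longleftrightarrow> has_root H (p ^ i) (f a)"
begin

lemma f_one: "f \<one> = \<one>\<^bsub>H\<^esub>"
  using f_pow[OF one_A, of 0] by simp

lemma f_eq_one_iff: "a \<in> A \<Longrightarrow> f a = \<one>\<^bsub>H\<^esub> \<longleftrightarrow> a = \<one>"
  using f_inj f_one one_A by (metis inj_onD)

text \<open>
  Adding $x \mapsto y$ determines the values on all powers of $x$. If every power of $x$ outside $A$ generates $x$, then
  the new values meet $f(A)$ only where they have to: an unexpected coincidence at such a power
  would put $y$ itself into $f(A)$. The same argument shows that $x$ and $y$ have the same order.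
\<close>

lemma extend:
  assumes x: "x \<in> carrier G" "x \<notin> A" and y: "y \<in> carrier H" "y \<notin> f ` A"
    and in_A: "\<And>t::nat. x [^] t \<in> A \<Longrightarrow> f (x [^] t) = y [^]\<^bsub>H\<^esub> t"
    and gen: "\<And>t::nat. x [^] t \<notin> A \<Longrightarrow> \<exists>s::nat. (x [^] t) [^] s = x"
    and root: "\<And>p k i. Factorial_Ring.prime p \<Longrightarrow> x [^] (p ^ k) = \<one> \<Longrightarrow>
      has_root G (p ^ i) x \<longleftrightarrow> has_root H (p ^ i) y"
  shows "\<exists>B f'. partial_power_iso G H B f' \<and> A \<subset> B"
proof -
  have one: "y [^]\<^bsub>H\<^esub> j = \<one>\<^bsub>H\<^esub>" if "x [^] j = \<one>" for j :: nat
    using in_A[of j] that one_A f_one by simp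
  have fix_y: "y [^]\<^bsub>H\<^esub> j = y" if "x [^] j = x" for j :: nat
  proof -
    have "j \<noteq> 0" using that x one_A by (metis G.nat_pow_0)
    then obtain i where i: "j = Suc i" using not0_implies_Suc by blast
    then have "x [^] i = \<one>" using that x by simp
    then show ?thesis using one[of i] y i by simp
  qed
  have gen_y: "\<exists>s::nat. (x [^] t) [^] s = x \<and> (y [^]\<^bsub>H\<^esub> t) [^]\<^bsub>H\<^esub> s = y" if nA: "x [^] t \<notin> A" for t :: nat
  proof -
    obtain s :: nat where s: "(x [^] t) [^] s = x" using gen[OF nA] by blast
    then have "y [^]\<^bsub>H\<^esub> (t * s) = y" using x by (intro fix_y) (simp add: G.nat_pow_pow)
    then show ?thesis using s y by (intro exI[of _ s]) (simp add: H.nat_pow_pow)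
  qed
  have avoid: "y [^]\<^bsub>H\<^esub> t \<notin> f ` A" if nA: "x [^] t \<notin> A" for t :: nat
  proof
    assume "y [^]\<^bsub>H\<^esub> t \<in> f ` A"
    then obtain a where a: "a \<in> A" "y [^]\<^bsub>H\<^esub> t = f a" by blast
    obtain s :: nat where "f a [^]\<^bsub>H\<^esub> s = y" using gen_y[OF nA] a(2) by auto
    then have "y = f (a [^] s)" using f_pow[OF a(1)] by simp
    then show False using y(2) pow_A[OF a(1)] by blast
  qed
  have one_iff: "x [^] j = \<one> \<longleftrightarrow> y [^]\<^bsub>H\<^esub> j = \<one>\<^bsub>H\<^esub>" for j :: nat
  proof (cases "x [^] j \<in> A")
    case True
    then show ?thesis using in_A f_eq_one_iff by metis
  next
    case False
    then show ?thesis using avoid one_A f_one by (metis imageI)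
  qed
  have "G.ord x = H.ord y"
    using x y one_iff H.pow_eq_id by (simp add: G.ord_unique)
  then have pow_eq: "x [^] i = x [^] j \<longleftrightarrow> y [^]\<^bsub>H\<^esub> i = y [^]\<^bsub>H\<^esub> j" for i j :: nat
    using G.int_pow_eq[OF x(1), of "int i" "int j"] H.int_pow_eq[OF y(1), of "int i" "int j"]
    by (simp add: int_pow_int)
  define f' where "f' z = (if z \<in> A then f z else y [^]\<^bsub>H\<^esub> (SOME t::nat. x [^] t = z))" for z
  have f'A: "f' a = f a" if "a \<in> A" for a
    using that by (simp add: f'_def)
  have f'x: "f' (x [^] t) = y [^]\<^bsub>H\<^esub> t" for t :: nat
  proof (cases "x [^] t \<in> A")
    case True
    then show ?thesis using in_A f'A by simp
  next
    case False
    have "x [^] (SOME s::nat. x [^] s = x [^] t) = x [^] t"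
      by (rule someI) simp
    then show ?thesis using False pow_eq by (simp add: f'_def)
  qed
  let ?B = "A \<union> range (\<lambda>t::nat. x [^] t)"
  have "partial_power_iso G H ?B f'"
  proof unfold_locales
    show "finite (carrier G)" "finite (carrier H)" by (fact finG finH)+
    show "?B \<subseteq> carrier G" using A_sub x by auto
    show "\<one> \<in> ?B" using one_A by simp
    show "a [^] t \<in> ?B" if "a \<in> ?B" for a and t :: nat
      using that pow_A x by (auto simp: G.nat_pow_pow)
    show "f' a \<in> carrier H" if "a \<in> ?B" for a
      using that f_carrier y by (auto simp: f'A f'x)
    show "f' (a [^] t) = f' a [^]\<^bsub>H\<^esub> t" if "a \<in> ?B" for a and t :: nat
      using that f_pow pow_A x y by (auto simp: f'A f'x G.nat_pow_pow H.nat_pow_pow)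
    show "inj_on f' ?B"
    proof (rule inj_onI)
      have mixed: "a = x [^] t" if "a \<in> A" "f' a = f' (x [^] t)" for a and t :: nat
      proof (cases "x [^] t \<in> A")
        case True
        then show ?thesis using that f_inj f'A by (metis inj_onD)
      next
        case False
        then show ?thesis using that avoid f'A f'x by (metis imageI)
      qed
      fix a b assume ab: "a \<in> ?B" "b \<in> ?B" "f' a = f' b"
      consider "a \<in> A" "b \<in> A" | t :: nat where "a \<in> A" "b = x [^] t" | t :: nat where "b \<in> A" "a = x [^] t"
        | s t :: nat where "a = x [^] s" "b = x [^] t"
        using ab by blast
      then show "a = b"
      proof cases
        case 1
        then show ?thesis using ab f_inj f'A by (metis inj_onD)
      next
        case 2
        then show ?thesis using mixed ab by blast
      next
        case 3
        then show ?thesis using mixed[of b t] ab by simp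
      next
        case 4
        then show ?thesis using ab pow_eq f'x by simp
      qed
    qed
    show "has_root G (p ^ i) a \<longleftrightarrow> has_root H (p ^ i) (f' a)"
      if a: "a \<in> ?B" and p: "Factorial_Ring.prime p" and ak: "a [^] (p ^ k) = \<one>" for a p k i
    proof (cases "a \<in> A")
      case True
      then show ?thesis using f_root[OF True p ak] f'A by simp
    next
      case False
      then obtain t where t: "a = x [^] (t::nat)" using a by blast
      obtain s :: nat where s: "a [^] s = x" "f' a [^]\<^bsub>H\<^esub> s = y"
        using gen_y[of t] False unfolding t f'x by blast
      have aG: "a \<in> carrier G" using t x by simp
      have "x [^] (p ^ k) = (a [^] (p ^ k)) [^] s"
        unfolding s(1)[symmetric] using aG by (simp add: G.nat_pow_pow mult.commute)
      then have "x [^] (p ^ k) = \<one>" using ak by simp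
      then have "has_root G (p ^ i) x \<longleftrightarrow> has_root H (p ^ i) y"
        using root p by blast
      moreover have "has_root G (p ^ i) a \<longleftrightarrow> has_root G (p ^ i) x"
        using G.has_root_pow[of "p ^ i" a s] G.has_root_pow[of "p ^ i" x t] s(1) t by auto
      moreover have "has_root H (p ^ i) (f' a) \<longleftrightarrow> has_root H (p ^ i) y"
        using H.has_root_pow[of "p ^ i" "f' a" s] H.has_root_pow[of "p ^ i" y t] s(2) t f'x by auto
      ultimately show ?thesis by blast
    qed
  qed
  moreover have "x \<in> ?B" using x by (auto intro!: range_eqI[of _ _ 1])
  ultimately show ?thesis using x by blast
qed

text \<open>
  For an element of minimal order outside $A$, a power $x^t$ either has smaller order and lies in $A$, or has
  exponent prime to the order of $x$ and generates $x$.
\<close>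

lemma extend_minimal:
  assumes x: "x \<in> carrier G" "x \<notin> A" and small: "\<And>z. z \<in> carrier G \<Longrightarrow> G.ord z < G.ord x \<Longrightarrow> z \<in> A"
    and y: "y \<in> carrier H" "y \<notin> f ` A"
    and in_A: "\<And>t::nat. x [^] t \<in> A \<Longrightarrow> f (x [^] t) = y [^]\<^bsub>H\<^esub> t"
    and root: "\<And>p k i. Factorial_Ring.prime p \<Longrightarrow> x [^] (p ^ k) = \<one> \<Longrightarrow>
      has_root G (p ^ i) x \<longleftrightarrow> has_root H (p ^ i) y"
  shows "\<exists>B f'. partial_power_iso G H B f' \<and> A \<subset> B"
proof (rule extend[OF x y in_A])
  fix t :: nat assume t: "x [^] t \<notin> A"
  have "coprime t (G.ord x)"
  proof (rule ccontr)
    assume nc: "\<not> coprime t (G.ord x)"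
    have pos: "G.ord x > 0" using G.ord_ge_1[OF finG x(1)] by simp
    have "G.ord x \<noteq> 1" using x one_A G.ord_eq_1 by metis
    moreover have "gcd (G.ord x) t > 1"
      using nc pos by (metis coprime_iff_gcd_eq_1 gcd.commute gcd_pos_nat less_one linorder_neqE_nat not_gr0)
    ultimately have "G.ord (x [^] t) < G.ord x"
      using x pos by (auto simp: G.ord_pow_gen)
    then show False using t small x by auto
  qed
  then obtain s r where "t * s = G.ord x * r + 1"
    using bezout_nat[of t "G.ord x"] x one_A t by (cases "t = 0") auto
  then have "(x [^] t) [^] s = x"
    using x by (simp add: G.nat_pow_pow) (simp flip: G.nat_pow_pow)
  then show "\<exists>s::nat. (x [^] t) [^] s = x" by blast
qed (use root in blast)+

text \<open>
  An element whose order has two coprime proper factors is the product of two powers of itself of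
  smaller order, on which $f$ is already defined. The product of their images serves as the
  image; these images commute because the target is nilpotent. Not being a
  $p$-element for any prime $p$, the new element has no height to preserve.
\<close>

lemma extend_composite:
  assumes nil: "nilpotent_group H"
    and x: "x \<in> carrier G" "x \<notin> A" and small: "\<And>z. z \<in> carrier G \<Longrightarrow> G.ord z < G.ord x \<Longrightarrow> z \<in> A"
    and ord_x: "G.ord x = m * l" and ml: "coprime m l" "m > 1" "l > 1"
  shows "\<exists>B f'. partial_power_iso G H B f' \<and> A \<subset> B"
proof -
  obtain u v where uv: "m dvd u" "l dvd v" "(u + v) mod (m * l) = 1 mod (m * l)"
    using coprime_idempotents[of m l] ml by auto
  have xml: "x [^] (m * l) = \<one>" using x G.pow_ord_eq_1 ord_x by metis
  have splitG: "z [^] u \<otimes> z [^] v = z" if "z \<in> carrier G" "z [^] (m * l) = \<one>" for z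
    using G.pow_cong[OF that uv(3)] that by (simp add: G.nat_pow_mult)
  have splitH: "z [^]\<^bsub>H\<^esub> u \<otimes>\<^bsub>H\<^esub> z [^]\<^bsub>H\<^esub> v = z" if "z \<in> carrier H" "z [^]\<^bsub>H\<^esub> (m * l) = \<one>\<^bsub>H\<^esub>" for z
    using H.pow_cong[OF that uv(3)] that by (simp add: H.nat_pow_mult)
  define a b where "a = x [^] u" and "b = x [^] v"
  have aG: "a \<in> carrier G" "b \<in> carrier G" using x by (simp_all add: a_def b_def)
  have al: "a [^] l = \<one>" and bm: "b [^] m = \<one>"
    using uv x ord_x by (simp_all add: a_def b_def G.nat_pow_pow G.pow_eq_id mult.commute[of m l] mult_dvd_mono)
  have "G.ord a < G.ord x" "G.ord b < G.ord x"
  proof -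
    have "G.ord a \<le> l" "G.ord b \<le> m"
      using al bm aG ml by (auto intro!: dvd_imp_le simp: G.pow_eq_id)
    then show "G.ord a < G.ord x" "G.ord b < G.ord x"
      using ml ord_x by (auto intro: le_less_trans)
  qed
  then have aA: "a \<in> A" and bA: "b \<in> A" using small aG by blast+
  have fH: "f a \<in> carrier H" "f b \<in> carrier H" using aA bA f_carrier by auto
  have fal: "f a [^]\<^bsub>H\<^esub> l = \<one>\<^bsub>H\<^esub>" and fbm: "f b [^]\<^bsub>H\<^esub> m = \<one>\<^bsub>H\<^esub>"
    using f_pow aA bA al bm f_one by metis+
  have comm: "f a \<otimes>\<^bsub>H\<^esub> f b = f b \<otimes>\<^bsub>H\<^esub> f a"
    using nilpotent_coprime_commute[OF nil fH fal fbm] ml by (simp add: coprime_commute)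
  define y where "y = f a \<otimes>\<^bsub>H\<^esub> f b"
  have yH: "y \<in> carrier H" using fH by (simp add: y_def)
  have y_pow: "y [^]\<^bsub>H\<^esub> t = f a [^]\<^bsub>H\<^esub> t \<otimes>\<^bsub>H\<^esub> f b [^]\<^bsub>H\<^esub> t" for t :: nat
    unfolding y_def by (rule H.pow_mult_distrib[OF comm fH])
  have kill: "f a [^]\<^bsub>H\<^esub> v = \<one>\<^bsub>H\<^esub>" "f b [^]\<^bsub>H\<^esub> u = \<one>\<^bsub>H\<^esub>"
    using uv fal fbm fH by (metis dvd_trans H.pow_eq_id)+
  have killml: "f a [^]\<^bsub>H\<^esub> (m * l) = \<one>\<^bsub>H\<^esub>" "f b [^]\<^bsub>H\<^esub> (m * l) = \<one>\<^bsub>H\<^esub>"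
    using fal fbm fH by (metis dvd_trans H.pow_eq_id dvd_triv_left dvd_triv_right)+
  have yu: "y [^]\<^bsub>H\<^esub> u = f a"
    using y_pow[of u] splitH[OF fH(1) killml(1)] kill fH by simp
  have yv: "y [^]\<^bsub>H\<^esub> v = f b"
    using y_pow[of v] splitH[OF fH(2) killml(2)] kill fH by simp
  have yml: "y [^]\<^bsub>H\<^esub> (m * l) = \<one>\<^bsub>H\<^esub>"
    using y_pow killml by simp
  show ?thesis
  proof (rule extend_minimal[OF x small yH])
    show "y \<notin> f ` A"
    proof
      assume "y \<in> f ` A"
      then obtain z where z: "z \<in> A" "y = f z" by blast
      then have zG: "z \<in> carrier G" using A_sub by blast
      have "f (z [^] u) = f a" "f (z [^] v) = f b"
        using z f_pow yu yv by simp_all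
      then have "z [^] u = a" "z [^] v = b"
        using z aA bA pow_A f_inj by (metis inj_onD)+
      moreover have "z [^] (m * l) = \<one>"
        using f_eq_one_iff[OF pow_A[OF z(1)]] f_pow z yml by simp
      ultimately have "z = a \<otimes> b"
        using splitG[OF zG] by simp
      then have "z = x"
        using splitG[OF x(1) xml] by (simp add: a_def b_def)
      then show False using z x by simp
    qed
    show "f (x [^] t) = y [^]\<^bsub>H\<^esub> t" if t: "x [^] t \<in> A" for t :: nat
    proof -
      have "(x [^] t) [^] (m * l) = \<one>"
        using x xml by (metis G.nat_pow_one G.nat_pow_pow mult.commute)
      then have "f (x [^] t) [^]\<^bsub>H\<^esub> (m * l) = \<one>\<^bsub>H\<^esub>"
        using f_pow[OF t] f_one by metis
      then have "f (x [^] t) = f (x [^] t) [^]\<^bsub>H\<^esub> u \<otimes>\<^bsub>H\<^esub> f (x [^] t) [^]\<^bsub>H\<^esub> v"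
        using splitH[OF f_carrier[OF t]] by simp
      also have "\<dots> = f ((x [^] t) [^] u) \<otimes>\<^bsub>H\<^esub> f ((x [^] t) [^] v)"
        using f_pow[OF t] by simp
      also have "\<dots> = f (a [^] t) \<otimes>\<^bsub>H\<^esub> f (b [^] t)"
        using x by (simp add: a_def b_def G.nat_pow_pow mult.commute)
      also have "\<dots> = y [^]\<^bsub>H\<^esub> t"
        using y_pow f_pow aA bA by simp
      finally show ?thesis .
    qed
    show "has_root G (p ^ i) x \<longleftrightarrow> has_root H (p ^ i) y"
      if p: "Factorial_Ring.prime p" and xp: "x [^] (p ^ k) = \<one>" for p k i
    proof -
      have "m * l dvd p ^ k" using xp x G.pow_eq_id ord_x by metis
      then have "m dvd p ^ k" "l dvd p ^ k"
        using dvd_trans dvd_triv_left dvd_triv_right by metis+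
      then obtain i j where "m = p ^ i" "l = p ^ j"
        using p by (auto simp: divides_primepow_nat)
      moreover then have "i > 0" "j > 0" using ml by (auto intro: gr0I)
      ultimately have "p dvd 1" using ml(1) by simp
      then show ?thesis using p by simp
    qed
  qed
qed

text \<open>
  If $x$ has prime power order, its image has to be a $p$-th root of $f(x^p)$ of the same height as
  $x$ that is not yet taken. Since $f$ preserves heights, \<open>alpha_group_branching\<close> makes the $p$-th roots of
  $x^p$ and of $f(x^p)$ of that height equally numerous. The taken ones on the side of $H$ all come from roots in
  $A$, and $x$ is not among those, so a free one is left.
\<close>

lemma extend_prime_power:
  assumes \<alpha>: "alpha_group G" "alpha_group H"
    and cards: "\<And>n::nat. card {z \<in> carrier G. z [^] n = \<one>} = card {z \<in> carrier H. z [^]\<^bsub>H\<^esub> n = \<one>\<^bsub>H\<^esub>}"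
    and x: "x \<in> carrier G" "x \<notin> A" and small: "\<And>z. z \<in> carrier G \<Longrightarrow> G.ord z < G.ord x \<Longrightarrow> z \<in> A"
    and p: "Factorial_Ring.prime p" and ord_x: "G.ord x = p ^ k"
  shows "\<exists>B f'. partial_power_iso G H B f' \<and> A \<subset> B"
proof -
  have x1: "x \<noteq> \<one>" using x one_A by blast
  then have "k \<noteq> 0" using ord_x x G.ord_eq_1 by (metis power_0)
  have p1: "p > 1" using p prime_gt_1_nat by blast
  have xk: "x [^] (p ^ k) = \<one>" using ord_x x G.pow_ord_eq_1 by metis
  define g where "g = x [^] p"
  have gG: "g \<in> carrier G" using x by (simp add: g_def)
  have g_pow: "g [^] (p ^ (k - 1)) = \<one>"
    using xk x \<open>k \<noteq> 0\<close> by (simp add: g_def G.nat_pow_pow flip: power_Suc)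
  have gA: "g \<in> A"
  proof (rule small[OF gG])
    have "G.ord g = p ^ k div p"
      unfolding g_def using x ord_x p1 \<open>k \<noteq> 0\<close> by (simp add: G.ord_pow)
    also have "\<dots> < p ^ k" using p1 by (intro div_less_dividend) auto
    finally show "G.ord g < G.ord x" using ord_x by simp
  qed
  have fg: "f g \<in> carrier H" "f g [^]\<^bsub>H\<^esub> (p ^ (k - 1)) = \<one>\<^bsub>H\<^esub>"
    using f_carrier[OF gA] f_pow[OF gA] g_pow f_one by metis+
  \<comment> \<open>The sets of p-th roots of g and of f g of height at least i.\<close>
  define KG where "KG i = {z \<in> carrier G. has_root G (p ^ i) z \<and> z [^] p = g}" for i
  define KH where "KH i = {z \<in> carrier H. has_root H (p ^ i) z \<and> z [^]\<^bsub>H\<^esub> p = f g}" for i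
  have finK: "finite (KG i)" "finite (KH i)" for i
    using finG finH by (simp_all add: KG_def KH_def)
  have card_K: "card (KG i) = card (KH i)" for i
  proof -
    have "card {z \<in> carrier G. z [^] (p ^ i) = \<one>} \<noteq> 0"
      using finG by (auto intro: exI[of _ "\<one>"])
    moreover have "card (KG i) * card {z \<in> carrier G. z [^] (p ^ i) = \<one>}
        = card (KH i) * card {z \<in> carrier G. z [^] (p ^ i) = \<one>}"
      using alpha_group_branching[OF \<alpha>(1) p gG g_pow, of i] alpha_group_branching[OF \<alpha>(2) p fg, of i]
        f_root[OF gA p g_pow, of "Suc i"] cards unfolding KG_def KH_def by simp
    ultimately show ?thesis by simp
  qed
  \<comment> \<open>Heights of nontrivial p-elements are finite; the order of the group is a crude bound.\<close>
  have no_root: "\<not> has_root G (p ^ order G) x"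
  proof
    assume "has_root G (p ^ order G) x"
    then obtain z where z: "z \<in> carrier G" "z [^] (p ^ order G) = x"
      unfolding has_root_def by blast
    then have "z [^] (p ^ (order G + k)) = \<one>"
      using xk by (metis G.nat_pow_pow power_add)
    then obtain j where j: "G.ord z = p ^ j"
      using z p G.pow_eq_id by (metis divides_primepow_nat)
    have "j < p ^ j" using p1 by (simp add: less_exp power_gt_expt)
    also have "p ^ j \<le> order G"
      using G.ord_le_group_order[OF finG z(1)] j by simp
    finally have "G.ord z dvd p ^ order G"
      using j by (simp add: le_imp_power_dvd)
    then show False using z x1 G.pow_eq_id by metis
  qed
  have down: "has_root G (p ^ j) z" if "has_root G (p ^ i) z" "j \<le> i" for i j z
    using that G.has_root_dvd le_imp_power_dvd by metis
  have downH: "has_root H (p ^ j) z" if "has_root H (p ^ i) z" "j \<le> i" for i j z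
    using that H.has_root_dvd le_imp_power_dvd by metis
  define e where "e = (LEAST i. \<not> has_root G (p ^ i) x)"
  have e: "\<not> has_root G (p ^ e) x"
    unfolding e_def using no_root by (rule LeastI)
  moreover have "has_root G (p ^ 0) x" using x by (auto simp: has_root_def)
  ultimately have "e \<noteq> 0" by metis
  then obtain d where d: "e = Suc d" using not0_implies_Suc by blast
  have xd: "has_root G (p ^ d) x"
    using not_less_Least[of d "\<lambda>i. \<not> has_root G (p ^ i) x"] d e_def by auto
  have heightG: "has_root G (p ^ i) x \<longleftrightarrow> i \<le> d" for i
    using xd e d down[of _ x] by (metis not_less_eq_eq)
  have sub: "KG (Suc d) \<subseteq> KG d" "KH (Suc d) \<subseteq> KH d"
    using down[of "Suc d" _ d] downH[of "Suc d" _ d] unfolding KG_def KH_def by auto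
  \<comment> \<open>The height of x is d, so these are the roots of the same height as x.\<close>
  let ?KG = "KG d - KG (Suc d)" and ?KH = "KH d - KH (Suc d)"
  have x_KG: "x \<in> ?KG"
    using xd e d x by (simp add: KG_def g_def)
  have "?KH \<inter> f ` A \<subseteq> f ` (?KG \<inter> A)"
  proof
    fix w assume w: "w \<in> ?KH \<inter> f ` A"
    then obtain a where a: "a \<in> A" "w = f a" by blast
    have "f (a [^] p) = f g" using w a f_pow by (simp add: KH_def)
    then have ap: "a [^] p = g" using a gA pow_A f_inj by (metis inj_onD)
    have "a [^] (p ^ k) = (a [^] p) [^] (p ^ (k - 1))"
      using a A_sub \<open>k \<noteq> 0\<close> by (subst G.nat_pow_pow) (auto simp flip: power_Suc)
    then have "a [^] (p ^ k) = \<one>" using ap g_pow by simp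
    then have "has_root G (p ^ i) a \<longleftrightarrow> has_root H (p ^ i) w" for i
      using f_root[OF a(1) p] a by blast
    then have "a \<in> ?KG"
      using w a ap A_sub by (auto simp: KG_def KH_def simp del: power_Suc)
    then show "w \<in> f ` (?KG \<inter> A)" using a by blast
  qed
  then have "card (?KH \<inter> f ` A) \<le> card (?KG \<inter> A)"
    using finK by (meson card_image_le card_mono finite_Diff finite_Int finite_imageI le_trans)
  also have "\<dots> < card ?KG"
    using x_KG x finK by (intro psubset_card_mono) auto
  also have "card ?KG = card ?KH"
    using card_K sub finK by (simp add: card_Diff_subset)
  finally have "\<not> ?KH \<subseteq> f ` A" by (metis inf.absorb1 less_irrefl)
  then obtain y where y: "y \<in> ?KH" "y \<notin> f ` A" by blast
  then have yH: "y \<in> carrier H" and yp: "y [^]\<^bsub>H\<^esub> p = f g" by (auto simp: KH_def)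
  have heightH: "has_root H (p ^ i) y \<longleftrightarrow> i \<le> d" for i
    using y downH[of _ y] unfolding KH_def by (metis (mono_tags, lifting) DiffE mem_Collect_eq not_less_eq_eq)
  show ?thesis
  proof (rule extend_minimal[OF x small yH y(2)])
    show "f (x [^] t) = y [^]\<^bsub>H\<^esub> t" if t: "x [^] t \<in> A" for t :: nat
    proof -
      have "p dvd t"
      proof (rule ccontr)
        assume "\<not> p dvd t"
        then have "coprime t (p ^ k)"
          using p by (simp add: prime_imp_coprime coprime_commute)
        then obtain s r where "t * s = p ^ k * r + 1"
          using bezout_nat[of t "p ^ k"] \<open>\<not> p dvd t\<close> by (cases "t = 0") auto
        then have "(x [^] t) [^] s = x"
          using x xk by (simp add: G.nat_pow_pow) (simp flip: G.nat_pow_pow)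
        then show False using pow_A[OF t, of s] x by simp
      qed
      then obtain s where s: "t = p * s" by blast
      then have "f (x [^] t) = f (g [^] s)"
        using x by (simp add: g_def G.nat_pow_pow)
      also have "\<dots> = y [^]\<^bsub>H\<^esub> t"
        using f_pow[OF gA] yH yp s by (simp flip: H.nat_pow_pow)
      finally show ?thesis .
    qed
    show "has_root G (q ^ i) x \<longleftrightarrow> has_root H (q ^ i) y"
      if "Factorial_Ring.prime q" "x [^] (q ^ j) = \<one>" for q j i
      using G.prime_power_orders_eq[OF x(1) x1 p that(1) xk that(2)] heightG heightH by simp
  qed
qed

end

text \<open>
  Start from the partial isomorphism between the trivial subgroups and keep adding an element of minimal order
  outside the domain. Domains grow strictly, so finiteness yields a total map, which is onto because
  the groups have the same order.
\<close>

theorem nilpotent_alpha_group_power_bijection: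
  fixes G :: "'a monoid" (structure) and H :: "'b monoid"
  assumes "nilpotent_alpha_group G" "nilpotent_alpha_group H" and eq: "order_multiset G = order_multiset H"
  obtains f where "bij_betw f (carrier G) (carrier H)"
    and "\<And>g t. g \<in> carrier G \<Longrightarrow> f (g [^] (t::nat)) = f g [^]\<^bsub>H\<^esub> t"
proof -
  have \<alpha>: "alpha_group G" "alpha_group H" and nil: "nilpotent_group H"
    and fg: "finite_group G" "finite_group H"
    using assms by (auto simp: nilpotent_alpha_group_def alpha_group_def)
  then have grp: "group G" "group H" and fin: "finite (carrier G)" "finite (carrier H)"
    by (auto simp: finite_group_def)
  interpret G: group G by fact
  interpret H: group H by fact
  have cards: "card {x \<in> carrier G. x [^] n = \<one>} = card {x \<in> carrier H. x [^]\<^bsub>H\<^esub> n = \<one>\<^bsub>H\<^esub>}" for n :: nat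
    using card_roots_of_one_eq_size_filter[OF fg(1)] card_roots_of_one_eq_size_filter[OF fg(2)] eq by simp
  have same_card: "card (carrier G) = card (carrier H)"
    using eq fin unfolding order_multiset_def by (metis size_image_mset size_mset_set)
  have step: "\<exists>B f'. partial_power_iso G H B f' \<and> A \<subset> B"
    if pp: "partial_power_iso G H A f" and A: "A \<noteq> carrier G" for A f
  proof -
    interpret partial_power_iso G H A f by fact
    define x where "x = arg_min G.ord (\<lambda>x. x \<in> carrier G \<and> x \<notin> A)"
    have "\<exists>x. x \<in> carrier G \<and> x \<notin> A" using A A_sub by blast
    then have x: "x \<in> carrier G" "x \<notin> A"
      and min: "\<And>z. z \<in> carrier G \<Longrightarrow> z \<notin> A \<Longrightarrow> G.ord x \<le> G.ord z"
      using arg_min_nat_lemma[of "\<lambda>x. x \<in> carrier G \<and> x \<notin> A" _ G.ord] unfolding x_def by blast+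
    have small: "z \<in> A" if "z \<in> carrier G" "G.ord z < G.ord x" for z
      using min that by (meson not_less)
    have "G.ord x \<noteq> 1" using x one_A G.ord_eq_1 by metis
    then obtain p where p: "Factorial_Ring.prime p" "p dvd G.ord x"
      using prime_factor_nat by blast
    have "G.ord x \<noteq> 0" using G.ord_ge_1[OF fin(1) x(1)] by simp
    define k where "k = multiplicity p (G.ord x)"
    obtain l where l: "G.ord x = p ^ k * l" "\<not> p dvd l"
      using p \<open>G.ord x \<noteq> 0\<close> multiplicity_decompose'[of "G.ord x" p] unfolding k_def
      by (metis not_prime_unit)
    have k: "k > 0" using p \<open>G.ord x \<noteq> 0\<close> by (simp add: k_def prime_multiplicity_gt_zero_iff)
    show ?thesis
    proof (cases "l = 1")
      case True
      then show ?thesis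
        using extend_prime_power[OF \<alpha> cards x small p(1), of k] l by simp
    next
      case False
      have "l \<noteq> 0" using l by (metis dvd_0_right)
      moreover have "coprime (p ^ k) l"
        using p l by (simp add: prime_imp_coprime)
      moreover have "p ^ k > 1"
        using k p prime_gt_1_nat by (metis one_less_power)
      ultimately show ?thesis
        using extend_composite[OF nil x small, of "p ^ k" l] l False by simp
    qed
  qed
  have "\<exists>A f. partial_power_iso G H A f \<and> (A = carrier G \<or> card A \<ge> n)" for n
  proof (induction n)
    case 0
    have "has_root G n \<one>" "has_root H n \<one>\<^bsub>H\<^esub>" for n
      by (auto simp: has_root_def intro: bexI[of _ "\<one>"] bexI[of _ "\<one>\<^bsub>H\<^esub>"])
    then have "partial_power_iso G H {\<one>} (\<lambda>_. \<one>\<^bsub>H\<^esub>)"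
      by unfold_locales (use fin in auto)
    then show ?case by auto
  next
    case (Suc n)
    then obtain A f where A: "partial_power_iso G H A f" "A = carrier G \<or> card A \<ge> n" by blast
    show ?case
    proof (cases "A = carrier G")
      case False
      then obtain B f' where B: "partial_power_iso G H B f'" "A \<subset> B"
        using step A by blast
      interpret B: partial_power_iso G H B f' by fact
      have "card A < card B"
        using B.A_sub fin B(2) by (meson finite_subset psubset_card_mono)
      then show ?thesis using A B False by (meson Suc_leI le_less_trans)
    qed (use A in blast)
  qed
  then obtain A f where A: "partial_power_iso G H A f" "A = carrier G \<or> card A \<ge> card (carrier G)"
    by blast
  interpret partial_power_iso G H A f by fact
  have AG: "A = carrier G"
    using A(2) A_sub fin by (metis card_seteq)
  have "f ` carrier G \<subseteq> carrier H" using f_carrier AG by blast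
  then have "f ` carrier G = carrier H"
    using f_inj AG fin same_card by (metis card_image card_subset_eq)
  then show ?thesis
    using that f_inj f_pow AG by (simp add: bij_betw_def)
qed

section \<open>Two groups of order 27 with the same element orders\<close>

lemma nilpotent_groupI_central_commutators:
  fixes G :: "'a monoid" (structure)
  assumes "group G"
    and central: "\<And>x y z. \<lbrakk>x \<in> carrier G; y \<in> carrier G; z \<in> carrier G\<rbrakk> \<Longrightarrow>
      (x \<otimes> y \<otimes> inv x \<otimes> inv y) \<otimes> z = z \<otimes> (x \<otimes> y \<otimes> inv x \<otimes> inv y)"
  shows "nilpotent_group G"
proof -
  interpret group G by fact
  define C where "C = (\<Union>h\<in>carrier G. \<Union>g\<in>carrier G. {h \<otimes> g \<otimes> inv h \<otimes> inv g})"
  have C: "C \<subseteq> carrier G" by (auto simp: C_def)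
  have comm: "c \<otimes> z = z \<otimes> c" if "c \<in> generate G C" "z \<in> carrier G" for c z
    using that
  proof (induction c rule: generate.induct)
    case (incl h)
    then show ?case using central by (auto simp: C_def)
  next
    case (inv h)
    then have h: "h \<in> carrier G" "h \<otimes> z = z \<otimes> h"
      using central C by (auto simp: C_def)
    have "inv h \<otimes> z = inv h \<otimes> (z \<otimes> h \<otimes> inv h)"
      using h inv.prems by (simp add: m_assoc)
    also have "\<dots> = inv h \<otimes> (h \<otimes> (z \<otimes> inv h))"
      using h inv.prems by (simp flip: h(2) add: m_assoc)
    also have "\<dots> = z \<otimes> inv h"
      using h inv.prems by (simp add: inv_cancel_left)
    finally show ?case .
  next
    case (eng h1 h2)
    have h: "h1 \<in> carrier G" "h2 \<in> carrier G"
      using eng.hyps C generate_in_carrier by blast+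
    have "h1 \<otimes> h2 \<otimes> z = h1 \<otimes> (h2 \<otimes> z)"
      using h eng.prems by (simp add: m_assoc)
    also have "\<dots> = (h1 \<otimes> z) \<otimes> h2"
      using h eng.prems eng.IH(2) by (simp add: m_assoc)
    also have "\<dots> = z \<otimes> (h1 \<otimes> h2)"
      using h eng.prems eng.IH(1) by (simp add: m_assoc)
    finally show ?case .
  qed simp
  have sub: "generate G C \<subseteq> carrier G" using C generate_incl by blast
  have "h \<otimes> g \<otimes> inv h \<otimes> inv g = \<one>" if "h \<in> generate G C" "g \<in> carrier G" for h g
    using comm[OF that] that sub by (auto simp: m_assoc subset_iff)
  then have "(\<Union>h\<in>generate G C. \<Union>g\<in>carrier G. {h \<otimes> g \<otimes> inv h \<otimes> inv g}) = {\<one>}"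
    using generate.one[of G C] by (auto 0 3 intro!: bexI[of _ \<one>])
  then have "lower_central G (Suc (Suc 0)) = {\<one>}"
    by (simp add: generate_one flip: C_def)
  then show ?thesis
    using \<open>group G\<close> unfolding nilpotent_group_def by blast
qed

text \<open>
  In exponent $p$ all powers of exponent $p^i$ with $i \geq 1$ are trivial, so only the identity has roots, and the
  condition on their number is vacuous. The only remaining point is that the cyclic subgroups, being of order 1
  or $p$, form a hereditary set.
\<close>

lemma alpha_groupI_exponent_prime:
  fixes G :: "'a monoid" (structure)
  assumes "finite_group G" and p: "Factorial_Ring.prime p" and ord: "order G = p ^ n"
    and exp: "\<And>x. x \<in> carrier G \<Longrightarrow> x [^] p = \<one>"
  shows "alpha_group G"
  unfolding alpha_group_def
proof (intro conjI allI impI)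
  show "finite_group G" by fact
  then have "group G" and fin: "finite (carrier G)" by (auto simp: finite_group_def)
  interpret group G by fact
  fix q assume q: "Factorial_Ring.prime q \<and> q dvd order G"
  then have "q = p"
    using p ord by (metis prime_dvd_power primes_dvd_imp_eq)
  let ?S = "cyclic_p_subgroups p G"
  have U: "\<Union>?S = carrier G"
    using exp by (auto simp: Union_cyclic_p_subgroups[OF \<open>group G\<close> p] intro: exI[of _ 1])
  have sub: "D \<in> ?S" if C: "C \<in> ?S" and D: "subgroup D (G\<lparr>carrier := C\<rparr>)" for C D
  proof -
    have CG: "subgroup C G" and cyc: "cyclic_group (G\<lparr>carrier := C\<rparr>)"
      using C by (auto simp: cyclic_p_subgroups_def cyclic_subgroups_def)
    have finC: "finite C" using CG fin subgroup.subset finite_subset by metis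
    interpret C: group "G\<lparr>carrier := C\<rparr>" using CG by (simp add: subgroup.subgroup_is_group)
    obtain c where c: "c \<in> C" "subgroup_generated (G\<lparr>carrier := C\<rparr>) {c} = G\<lparr>carrier := C\<rparr>"
      using cyc by (auto simp: cyclic_group_def)
    then have "card C = C.ord c"
      using C.cyclic_order_is_ord[of c] by (simp add: order_def)
    moreover have "c [^]\<^bsub>G\<lparr>carrier := C\<rparr>\<^esub> p = \<one>"
      using exp[of c] c(1) CG subgroup.subset by (auto simp flip: nat_pow_consistent)
    then have "C.ord c dvd p"
      using C.pow_eq_id[of c p] c(1) by simp
    moreover have DC: "D \<subseteq> C" using D subgroup.subset by fastforce
    moreover have "card D dvd card C"
      using C.lagrange[OF D] by (simp add: order_def) (metis dvd_triv_right)
    ultimately consider "card D = card C" | "card D = 1"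
      using p by (metis dvd_trans prime_nat_iff dvd_antisym nat_dvd_1_iff_1)
    then show ?thesis
    proof cases
      case 1
      then show ?thesis using C DC finC by (metis card_subset_eq)
    next
      case 2
      moreover have "\<one> \<in> D" using D subgroup.one_closed by fastforce
      ultimately have "D = {\<one>}" by (metis card_1_singletonE singletonD)
      then show ?thesis
        using generate_in_cyclic_p_subgroups[OF \<open>group G\<close> p, of \<one>] by (simp add: generate_one)
    qed
  qed
  have "\<one> \<in> \<Union>?S" using U by simp
  then have "?S \<noteq> {}" by blast
  moreover have "?S \<subseteq> cyclic_subgroups G" unfolding cyclic_p_subgroups_def by blast
  ultimately have her: "hereditary G ?S"
    unfolding hereditary_def using sub by blast
  have pow1: "x [^] (p ^ i) = \<one>" if x: "x \<in> carrier G" and "i \<ge> 1" for x and i :: nat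
  proof -
    obtain j where "i = Suc j" using \<open>i \<ge> 1\<close> by (cases i) auto
    then have "x [^] (p ^ i) = (x [^] p) [^] (p ^ j)" using x by (simp add: nat_pow_pow)
    then show ?thesis using exp x by simp
  qed
  have count: "card {x \<in> \<Union>?S. x [^] (p ^ i) = g} \<in> {0, card {x \<in> \<Union>?S. x [^] (p ^ i) = \<one>}}"
    if "i \<ge> 1" for i g
  proof (cases "g = \<one>")
    case False
    then have "{x \<in> \<Union>?S. x [^] (p ^ i) = g} = {}"
      using U pow1 that by auto
    then show ?thesis by (metis card.empty insertI1)
  qed simp
  show "alpha_set G (cyclic_p_subgroups q G)"
    unfolding alpha_set_def \<open>q = p\<close>
    using p q \<open>q = p\<close> her count by (intro conjI exI[of _ p]) simp_all
qed

definition ternary_digit :: "nat \<Rightarrow> nat \<Rightarrow> nat" where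
  "ternary_digit i x = x div 3 ^ i mod 3"

definition of_ternary :: "nat \<Rightarrow> nat \<Rightarrow> nat \<Rightarrow> nat" where
  "of_ternary a b c = a mod 3 + 3 * (b mod 3) + 9 * (c mod 3)"

lemma ternary_digit_of_ternary [simp]:
  "ternary_digit 0 (of_ternary a b c) = a mod 3"
  "ternary_digit (Suc 0) (of_ternary a b c) = b mod 3"
  "ternary_digit 2 (of_ternary a b c) = c mod 3"
proof -
  have *: "of_ternary a b c = a mod 3 + 3 * (b mod 3 + 3 * (c mod 3))"
    by (simp add: of_ternary_def)
  have div3: "of_ternary a b c div 3 = b mod 3 + 3 * (c mod 3)"
    unfolding * by simp
  have div9: "of_ternary a b c div 3\<^sup>2 = c mod 3"
    unfolding power2_eq_square div_mult2_eq div3 by simp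
  show "ternary_digit 0 (of_ternary a b c) = a mod 3"
    by (simp only: ternary_digit_def * power_0 div_by_1 mod_mult_self2 mod_mod_trivial)
  show "ternary_digit (Suc 0) (of_ternary a b c) = b mod 3"
    by (simp add: ternary_digit_def div3)
  show "ternary_digit 2 (of_ternary a b c) = c mod 3"
    unfolding ternary_digit_def div9 by simp
qed

lemma of_ternary_ternary_digit:
  assumes "x < 27"
  shows "of_ternary (ternary_digit 0 x) (ternary_digit 1 x) (ternary_digit 2 x) = x"
proof -
  have "x div 9 = x div 3 div 3" by (simp flip: div_mult2_eq)
  moreover have "x div 9 mod 3 = x div 9" using assms by simp
  moreover have "of_ternary (ternary_digit 0 x) (ternary_digit 1 x) (ternary_digit 2 x)
      = x mod 3 + 3 * (x div 3 mod 3) + 9 * (x div 9 mod 3)"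
    by (simp add: ternary_digit_def of_ternary_def)
  ultimately show ?thesis
    using mult_div_mod_eq[of 3 x] mult_div_mod_eq[of 3 "x div 3"] by linarith
qed

lemma of_ternary_less: "of_ternary a b c < 27"
proof -
  have "a mod 3 < 3" "b mod 3 < 3" "c mod 3 < 3" by simp_all
  then show ?thesis unfolding of_ternary_def by linarith
qed

lemma of_ternary_cong:
  "a mod 3 = a' mod 3 \<Longrightarrow> b mod 3 = b' mod 3 \<Longrightarrow> c mod 3 = c' mod 3 \<Longrightarrow> of_ternary a b c = of_ternary a' b' c'"
  by (simp add: of_ternary_def)

text \<open>
  Triples $(a,b,c)$ of residues modulo 3, stored as ternary digits to obtain groups on natural numbers, with
  product $(a+a', b+b', c+c'+rab')$. The value $r = 1$ gives the Heisenberg group of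
  unitriangular $3 \times 3$ matrices over the field with 3 elements and $r = 0$ the elementary abelian group. Keeping $r$ a
  parameter lets one computation serve both groups.
\<close>

definition heisenberg27 :: "nat \<Rightarrow> nat monoid" where
  "heisenberg27 r = \<lparr>carrier = {..<27},
     monoid.mult = (\<lambda>x y. of_ternary (ternary_digit 0 x + ternary_digit 0 y) (ternary_digit 1 x + ternary_digit 1 y)
       (ternary_digit 2 x + ternary_digit 2 y + r * ternary_digit 0 x * ternary_digit 1 y)),
     one = 0\<rparr>"

lemma heisenberg27_carrier [simp]: "carrier (heisenberg27 r) = {..<27}"
  and heisenberg27_one [simp]: "\<one>\<^bsub>heisenberg27 r\<^esub> = 0"
  by (simp_all add: heisenberg27_def)

lemma heisenberg27_mult:
  "of_ternary a b c \<otimes>\<^bsub>heisenberg27 r\<^esub> of_ternary a' b' c' = of_ternary (a + a') (b + b') (c + c' + r * a * b')"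
proof -
  have "(c mod 3 + c' mod 3 + r * (a mod 3) * (b' mod 3)) mod 3 = (c + c' + r * a * b') mod 3"
    by (rule mod_add_cong; rule mod_add_cong mod_mult_cong; (rule mod_mult_cong)?; simp)
  then show ?thesis
    unfolding heisenberg27_def by simp (rule of_ternary_cong; simp add: mod_add_eq)
qed

lemma heisenberg27_cases:
  assumes "x \<in> carrier (heisenberg27 r)"
  obtains a b c where "x = of_ternary a b c"
  using assms of_ternary_ternary_digit by (metis heisenberg27_carrier lessThan_iff)

lemma of_ternary_eq_zero: "3 dvd a \<Longrightarrow> 3 dvd b \<Longrightarrow> 3 dvd c \<Longrightarrow> of_ternary a b c = 0"
  by (simp add: of_ternary_def mod_eq_0_iff_dvd)

lemma heisenberg27_inverse:
  "of_ternary (2 * a) (2 * b) (2 * c + r * a * b) \<otimes>\<^bsub>heisenberg27 r\<^esub> of_ternary a b c = 0"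
  unfolding heisenberg27_mult
proof (rule of_ternary_eq_zero)
  have "2 * c + r * a * b + c + r * (2 * a) * b = 3 * (c + r * a * b)"
    by (simp add: algebra_simps)
  then show "3 dvd 2 * c + r * a * b + c + r * (2 * a) * b"
    by (metis dvd_triv_left)
qed presburger+

lemma heisenberg27_group: "group (heisenberg27 r)"
proof (rule groupI)
  show "\<one>\<^bsub>heisenberg27 r\<^esub> \<in> carrier (heisenberg27 r)" by simp
  show "x \<otimes>\<^bsub>heisenberg27 r\<^esub> y \<in> carrier (heisenberg27 r)" for x y
    by (simp add: heisenberg27_def of_ternary_less)
  show "x \<otimes>\<^bsub>heisenberg27 r\<^esub> y \<otimes>\<^bsub>heisenberg27 r\<^esub> z = x \<otimes>\<^bsub>heisenberg27 r\<^esub> (y \<otimes>\<^bsub>heisenberg27 r\<^esub> z)"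
    if "x \<in> carrier (heisenberg27 r)" "y \<in> carrier (heisenberg27 r)" "z \<in> carrier (heisenberg27 r)" for x y z
  proof -
    from that obtain a b c a' b' c' a'' b'' c''
      where "x = of_ternary a b c" "y = of_ternary a' b' c'" "z = of_ternary a'' b'' c''"
      by (meson heisenberg27_cases)
    then show ?thesis by (simp add: heisenberg27_mult algebra_simps)
  qed
  show "\<one>\<^bsub>heisenberg27 r\<^esub> \<otimes>\<^bsub>heisenberg27 r\<^esub> x = x" if "x \<in> carrier (heisenberg27 r)" for x
  proof -
    from that obtain a b c where "x = of_ternary a b c" by (rule heisenberg27_cases)
    then show ?thesis using heisenberg27_mult[where a=0 and b=0 and c=0 and r=r] by (simp add: of_ternary_eq_zero)
  qed
  show "\<exists>y\<in>carrier (heisenberg27 r). y \<otimes>\<^bsub>heisenberg27 r\<^esub> x = \<one>\<^bsub>heisenberg27 r\<^esub>"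
    if x: "x \<in> carrier (heisenberg27 r)" for x
  proof -
    obtain a b c where "x = of_ternary a b c" using x by (rule heisenberg27_cases)
    then show ?thesis
      by (intro bexI[where x = "of_ternary (2 * a) (2 * b) (2 * c + r * a * b)"])
        (simp_all add: heisenberg27_inverse of_ternary_less)
  qed
qed

lemma heisenberg27_cube:
  assumes "x \<in> carrier (heisenberg27 r)"
  shows "x [^]\<^bsub>heisenberg27 r\<^esub> (3::nat) = 0"
proof -
  interpret group "heisenberg27 r" by (rule heisenberg27_group)
  obtain a b c where x: "x = of_ternary a b c" using assms by (rule heisenberg27_cases)
  have "x [^]\<^bsub>heisenberg27 r\<^esub> (3::nat) = x \<otimes>\<^bsub>heisenberg27 r\<^esub> x \<otimes>\<^bsub>heisenberg27 r\<^esub> x"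
    by (simp only: numeral_3_eq_3 nat_pow_Suc nat_pow_0 l_one[OF assms])
  also have "\<dots> = of_ternary (a + a + a) (b + b + b) (c + c + r * a * b + c + r * (a + a) * b)"
    unfolding x heisenberg27_mult ..
  also have "\<dots> = 0"
  proof (rule of_ternary_eq_zero)
    have "c + c + r * a * b + c + r * (a + a) * b = 3 * (c + r * a * b)"
      by (simp add: algebra_simps)
    then show "3 dvd c + c + r * a * b + c + r * (a + a) * b" by (metis dvd_triv_left)
  qed presburger+
  finally show ?thesis .
qed

lemma heisenberg27_nilpotent_alpha: "nilpotent_alpha_group (heisenberg27 r)"
proof -
  interpret group "heisenberg27 r" by (rule heisenberg27_group)
  have "alpha_group (heisenberg27 r)"
  proof (rule alpha_groupI_exponent_prime)
    show "finite_group (heisenberg27 r)" by (simp add: finite_group_def heisenberg27_group)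
    show "Factorial_Ring.prime (3::nat)" by simp
    show "order (heisenberg27 r) = 3 ^ 3" by (simp add: order_def)
    show "x [^]\<^bsub>heisenberg27 r\<^esub> (3::nat) = \<one>\<^bsub>heisenberg27 r\<^esub>"
      if "x \<in> carrier (heisenberg27 r)" for x
      using heisenberg27_cube[OF that] by simp
  qed
  moreover have "nilpotent_group (heisenberg27 r)"
  proof (rule nilpotent_groupI_central_commutators[OF heisenberg27_group])
    fix x y z
    assume "x \<in> carrier (heisenberg27 r)" "y \<in> carrier (heisenberg27 r)" "z \<in> carrier (heisenberg27 r)"
    then obtain a b c a' b' c' a'' b'' c'' where xyz: "x = of_ternary a b c" "y = of_ternary a' b' c'" "z = of_ternary a'' b'' c''"
      by (meson heisenberg27_cases)
    have inv: "inv\<^bsub>heisenberg27 r\<^esub> of_ternary a b c = of_ternary (2 * a) (2 * b) (2 * c + r * a * b)" for a b c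
      by (rule inv_equality) (simp_all add: heisenberg27_inverse of_ternary_less)
    \<comment> \<open>Only the shape of a commutator matters: its first two digits vanish, which makes it central.\<close>
    have "x \<otimes>\<^bsub>heisenberg27 r\<^esub> y \<otimes>\<^bsub>heisenberg27 r\<^esub> inv\<^bsub>heisenberg27 r\<^esub> x \<otimes>\<^bsub>heisenberg27 r\<^esub> inv\<^bsub>heisenberg27 r\<^esub> y
       = of_ternary 0 0 (c + c' + r * a * b' + (2 * c + r * a * b) + r * (a + a') * (2 * b)
           + (2 * c' + r * a' * b') + r * (a + a' + 2 * a) * (2 * b'))"
      unfolding xyz inv heisenberg27_mult by (rule of_ternary_cong) (presburger, presburger, rule refl)
    then show "x \<otimes>\<^bsub>heisenberg27 r\<^esub> y \<otimes>\<^bsub>heisenberg27 r\<^esub> inv\<^bsub>heisenberg27 r\<^esub> x \<otimes>\<^bsub>heisenberg27 r\<^esub> inv\<^bsub>heisenberg27 r\<^esub> y \<otimes>\<^bsub>heisenberg27 r\<^esub> z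
       = z \<otimes>\<^bsub>heisenberg27 r\<^esub> (x \<otimes>\<^bsub>heisenberg27 r\<^esub> y \<otimes>\<^bsub>heisenberg27 r\<^esub> inv\<^bsub>heisenberg27 r\<^esub> x \<otimes>\<^bsub>heisenberg27 r\<^esub> inv\<^bsub>heisenberg27 r\<^esub> y)"
      by (simp only: xyz(3) heisenberg27_mult) (simp add: add.commute)
  qed
  ultimately show ?thesis by (simp add: nilpotent_alpha_group_def)
qed

lemma heisenberg27_ord:
  assumes "x \<in> carrier (heisenberg27 r)"
  shows "group.ord (heisenberg27 r) x = (if x = 0 then 1 else 3)"
proof -
  interpret group "heisenberg27 r" by (rule heisenberg27_group)
  have "ord x dvd 3"
    using heisenberg27_cube[OF assms] pow_eq_id[OF assms, of 3] by simp
  moreover have "Factorial_Ring.prime (3::nat)" by simp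
  ultimately have "ord x = 1 \<or> ord x = 3"
    by (simp only: prime_nat_iff)
  then show ?thesis
    using ord_eq_1[OF assms] by auto
qed

lemma heisenberg27_order_multiset_eq: "heisenberg27 r \<sim>\<^sub>6 heisenberg27 s"
  unfolding sim6_def order_multiset_def
  by (auto simp: heisenberg27_ord intro!: image_mset_cong)

lemma heisenberg27_not_iso: "\<not> heisenberg27 1 \<sim>\<^sub>1 heisenberg27 0"
proof
  assume "heisenberg27 1 \<sim>\<^sub>1 heisenberg27 0"
  then obtain h where hom: "h \<in> hom (heisenberg27 1) (heisenberg27 0)" and inj: "inj_on h {..<27}"
    by (auto simp: sim1_def is_iso_def iso_def bij_betw_def)
  have comm: "x \<otimes>\<^bsub>heisenberg27 0\<^esub> y = y \<otimes>\<^bsub>heisenberg27 0\<^esub> x" for x y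
    by (simp add: heisenberg27_def add.commute)
  let ?x = "of_ternary 1 0 0" and ?y = "of_ternary 0 1 0"
  have "h (?x \<otimes>\<^bsub>heisenberg27 1\<^esub> ?y) = h (?y \<otimes>\<^bsub>heisenberg27 1\<^esub> ?x)"
    using hom comm by (simp add: hom_def of_ternary_less)
  then have "?x \<otimes>\<^bsub>heisenberg27 1\<^esub> ?y = ?y \<otimes>\<^bsub>heisenberg27 1\<^esub> ?x"
    using inj by (simp add: heisenberg27_mult inj_on_eq_iff of_ternary_less)
  then show False
    by (simp add: heisenberg27_mult) (simp add: of_ternary_def)
qed

section \<open>Comparing the three relations\<close>

lemma nilpotent_alpha_group_imp_finite_group:
  assumes "nilpotent_alpha_group G"
  shows "group G" "finite (carrier G)"
  using assms by (simp_all add: nilpotent_alpha_group_def alpha_group_def finite_group_def)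

lemma iso_imp_sim2:
  fixes G :: "'a monoid" and H :: "'b monoid"
  assumes "group G" "group H" "G \<cong> H"
  shows "G \<sim>\<^sub>2 H"
proof -
  from assms(3) obtain h where "h \<in> hom G H" "bij_betw h (carrier G) (carrier H)"
    by (auto simp: is_iso_def iso_def)
  moreover from this have "h (g [^]\<^bsub>G\<^esub> t) = h g [^]\<^bsub>H\<^esub> t" if "g \<in> carrier G" for g and t :: int
    using hom_int_pow that assms(1,2) by metis
  ultimately show ?thesis
    unfolding sim2_def by (intro exI[of _ h]) simp
qed

lemma sim2_imp_sim6:
  fixes G :: "'a monoid" and H :: "'b monoid"
  assumes "group G" "group H" "finite (carrier G)" "G \<sim>\<^sub>2 H"
  shows "G \<sim>\<^sub>6 H"
proof -
  interpret G: group G by fact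
  interpret H: group H by fact
  obtain f where bij: "bij_betw f (carrier G) (carrier H)"
    and pow: "\<And>g (t::int). g \<in> carrier G \<Longrightarrow> f (g [^]\<^bsub>G\<^esub> t) = f g [^]\<^bsub>H\<^esub> t"
    using assms(4) unfolding sim2_def by blast
  have f1: "f \<one>\<^bsub>G\<^esub> = \<one>\<^bsub>H\<^esub>"
    using pow[of "\<one>\<^bsub>G\<^esub>" 0] by simp
  have ord: "H.ord (f g) = G.ord g" if g: "g \<in> carrier G" for g
  proof -
    have fg: "f g \<in> carrier H" using bij g by (auto simp: bij_betw_def)
    have "f g [^]\<^bsub>H\<^esub> n = \<one>\<^bsub>H\<^esub> \<longleftrightarrow> G.ord g dvd n" for n :: nat
    proof -
      have "f g [^]\<^bsub>H\<^esub> n = f (g [^]\<^bsub>G\<^esub> n)"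
        using pow[OF g, of "int n"] by (simp add: int_pow_int)
      also have "\<dots> = \<one>\<^bsub>H\<^esub> \<longleftrightarrow> g [^]\<^bsub>G\<^esub> n = \<one>\<^bsub>G\<^esub>"
        using bij g f1 inj_on_eq_iff[of f "carrier G" "g [^]\<^bsub>G\<^esub> n" "\<one>\<^bsub>G\<^esub>"]
        by (simp add: bij_betw_def)
      finally show ?thesis using G.pow_eq_id g by simp
    qed
    then show ?thesis using H.ord_unique[OF fg] by blast
  qed
  have "order_multiset H = image_mset H.ord (image_mset f (mset_set (carrier G)))"
    using bij by (simp add: order_multiset_def bij_betw_def image_mset_mset_set)
  also have "\<dots> = order_multiset G"
    using assms(3) ord by (auto simp: order_multiset_def image_mset.compositionality intro!: image_mset_cong)
  finally show ?thesis by (simp add: sim6_def)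
qed

text \<open>
  The bijection built above respects natural exponents; an integer exponent may be replaced by
  its residue modulo the common order of the two groups.
\<close>

lemma sim6_imp_sim2:
  fixes G :: "'a monoid" and H :: "'b monoid"
  assumes nil: "nilpotent_alpha_group G" "nilpotent_alpha_group H" and "G \<sim>\<^sub>6 H"
  shows "G \<sim>\<^sub>2 H"
proof -
  have grp: "group G" "group H" and fin: "finite (carrier G)" "finite (carrier H)"
    using nil by (auto simp: nilpotent_alpha_group_def alpha_group_def finite_group_def)
  interpret G: group G by fact
  interpret H: group H by fact
  obtain f where bij: "bij_betw f (carrier G) (carrier H)"
    and pow: "\<And>g t. g \<in> carrier G \<Longrightarrow> f (g [^]\<^bsub>G\<^esub> (t::nat)) = f g [^]\<^bsub>H\<^esub> t"
    using nilpotent_alpha_group_power_bijection[OF nil assms(3)[unfolded sim6_def]] by metis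
  have same: "order H = order G"
    using bij bij_betw_same_card by (metis order_def)
  have "f (g [^]\<^bsub>G\<^esub> t) = f g [^]\<^bsub>H\<^esub> t" if g: "g \<in> carrier G" for g and t :: int
  proof -
    have fg: "f g \<in> carrier H" using bij g by (auto simp: bij_betw_def)
    define s where "s = nat (t mod int (order G))"
    have "order G > 0" using fin by (simp add: G.order_gt_0_iff_finite)
    then have s: "int (order G) dvd t - int s"
      by (simp add: s_def minus_mod_eq_mult_div)
    have "g [^]\<^bsub>G\<^esub> t = g [^]\<^bsub>G\<^esub> s"
      using G.int_pow_eq[OF g, of "int s" t] G.ord_dvd_group_order[OF g] s
      by (metis dvd_trans int_dvd_int_iff int_pow_int)
    moreover have "f g [^]\<^bsub>H\<^esub> t = f g [^]\<^bsub>H\<^esub> s"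
      using H.int_pow_eq[OF fg, of "int s" t] H.ord_dvd_group_order[OF fg] s same
      by (metis dvd_trans int_dvd_int_iff int_pow_int)
    ultimately show ?thesis using pow g by simp
  qed
  then show ?thesis using bij unfolding sim2_def by (intro exI[of _ f]) simp
qed

theorem theorem1p10:
  shows "partition_le ((\<sim>\<^sub>1) :: 'a monoid \<Rightarrow> 'b monoid \<Rightarrow> bool) (\<sim>\<^sub>2)
       \<and> \<not> partition_eq ((\<sim>\<^sub>1) :: nat monoid \<Rightarrow> nat monoid \<Rightarrow> bool) (\<sim>\<^sub>2)
       \<and> partition_eq ((\<sim>\<^sub>2) :: 'a monoid \<Rightarrow> 'b monoid \<Rightarrow> bool) (\<sim>\<^sub>6)"
proof (intro conjI)
  show "partition_le ((\<sim>\<^sub>1) :: 'a monoid \<Rightarrow> 'b monoid \<Rightarrow> bool) (\<sim>\<^sub>2)"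
    unfolding partition_le_def
  proof (intro allI impI)
    fix G :: "'a monoid" and H :: "'b monoid"
    assume GH: "nilpotent_alpha_group G \<and> nilpotent_alpha_group H" and iso: "G \<sim>\<^sub>1 H"
    have "group G" "group H"
      using GH by (simp_all add: nilpotent_alpha_group_imp_finite_group)
    then show "G \<sim>\<^sub>2 H"
      using iso by (simp add: iso_imp_sim2 sim1_def)
  qed
  show "partition_eq ((\<sim>\<^sub>2) :: 'a monoid \<Rightarrow> 'b monoid \<Rightarrow> bool) (\<sim>\<^sub>6)"
    unfolding partition_eq_def
  proof (intro allI impI)
    fix G :: "'a monoid" and H :: "'b monoid"
    assume GH: "nilpotent_alpha_group G \<and> nilpotent_alpha_group H"
    then have "group G" "group H" "finite (carrier G)"
      by (simp_all add: nilpotent_alpha_group_imp_finite_group)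
    then show "G \<sim>\<^sub>2 H \<longleftrightarrow> G \<sim>\<^sub>6 H"
      using GH sim2_imp_sim6[of G H] sim6_imp_sim2[of G H] by (intro iffI) simp_all
  qed
  have "heisenberg27 1 \<sim>\<^sub>2 heisenberg27 0"
    by (rule sim6_imp_sim2[OF heisenberg27_nilpotent_alpha heisenberg27_nilpotent_alpha heisenberg27_order_multiset_eq])
  then show "\<not> partition_eq ((\<sim>\<^sub>1) :: nat monoid \<Rightarrow> nat monoid \<Rightarrow> bool) (\<sim>\<^sub>2)"
    unfolding partition_eq_def using heisenberg27_not_iso heisenberg27_nilpotent_alpha by metis
qed

end
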